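(* If $\alpha \in \mathcal{S}$, then $\alpha$ cannot be expressed as $\frac{p}{q}$ with $p \in \mathbb{Z}$ and $q \in \mathbb{N}$; that is, every element of $\mathcal{S}$ is irrational.
   Context: $\mathbb{N}=\{1,2,3,\dots\}$, and $\mathbb{Q}^{+}$ is the set of positive rational numbers. For $b\in\mathbb{Q}^{+}$ and $m\in\mathbb{N}$, $\sqrt[m]{b}$ denotes the positive real $m$-th root of $b$. Let $$U = \{\sqrt[m]{b} \mid b \in \mathbb{Q}^{+},\ m \in \mathbb{N} \setminus \{1\},\ \sqrt[m]{b} \notin \mathbb{Q}\}.$$ Let $\mathcal{S}$ be the set of all real numbers $\alpha$ that can be written as a finite rational linear combination $\alpha = r_1 u_1 + \cdots + r_n u_n$ ($n\in\mathbb{N}$, $r_i \in \mathbb{Q}$, $u_i \in U$) in which the terms do not trivially cancel out upon simplifying the radicals. Precisely: call $u_i$ and $u_j$ equivalent if $u_i/u_j \in \mathbb{Q}$; the terms do not trivially cancel out if for at least one equivalence class $C\subseteq\{1,\dots,n\}$ of indices one has $\sum_{i\in C} r_i u_i \neq 0$. (For example, the expression $3\sqrt{12} - 5\sqrt{3} - \sqrt[4]{9}$ is excluded, since it simplifies to $6\sqrt{3} - 5\sqrt{3} - \sqrt{3} = 0$.) *)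

theory Defs
  imports Complex_Main
begin

definition irrational_radicals :: "real set" where
  "irrational_radicals =
     {root m (of_rat b) | (b :: rat) (m :: nat). b > 0 \<and> m \<ge> 2 \<and> root m (of_rat b) \<notin> \<rat>}"

definition radical_equiv :: "nat \<Rightarrow> (nat \<Rightarrow> real) \<Rightarrow> (nat \<times> nat) set" where
  "radical_equiv n u = {(i, j). i \<in> {1..n} \<and> j \<in> {1..n} \<and> u i / u j \<in> \<rat>}"

(* The quotient {1..n} // radical_equiv n u is the set of equivalence classes of indices. *)
definition not_trivially_cancelling :: "nat \<Rightarrow> (nat \<Rightarrow> rat) \<Rightarrow> (nat \<Rightarrow> real) \<Rightarrow> bool" where
  "not_trivially_cancelling n r u \<longleftrightarrow>
     (\<exists>C \<in> {1..n} // radical_equiv n u. (\<Sum>i\<in>C. of_rat (r i) * u i) \<noteq> 0)"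

definition radical_combinations :: "real set" where
  "radical_combinations =
     {\<alpha>. \<exists>(n :: nat) (r :: nat \<Rightarrow> rat) (u :: nat \<Rightarrow> real).
        n \<ge> 1 \<and> (\<forall>i\<in>{1..n}. u i \<in> irrational_radicals) \<and>
        not_trivially_cancelling n r u \<and>
        \<alpha> = (\<Sum>i=1..n. of_rat (r i) * u i)}"

end

(* A trace argument. Dividing by a member of a class with nonzero sum, it suffices that 1 is not a
   rational combination of irrational real radicals. Such radicals all act by multiplication on a
   finite-dimensional rational subspace W of the reals. If x is a positive radical and n > 0 is minimal
   with x^n rational, then X^n - x^n is irreducible over the rationals: all its complex roots have
   modulus x, so a factor of degree d has constant coefficient of modulus a rational multiple of x^d.
   Hence an irrational radical has trace 0 on W, whereas 1 has trace dim W. *)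

theory Submission
  imports Defs "HOL-Computational_Algebra.Fundamental_Theorem_Algebra"
    "HOL-Computational_Algebra.Polynomial_Factorial" "HOL-Computational_Algebra.Field_as_Ring"
begin

section \<open>Rational polynomials at radicals\<close>

lemma of_real_of_rat: "of_real (of_rat q) = (of_rat q :: 'a::{field_char_0,real_normed_field})"
  by (cases q) (simp add: of_rat_rat)

lemma map_poly_of_rat_mult:
  "map_poly (of_rat :: rat \<Rightarrow> 'a::field_char_0) (p * q) = map_poly of_rat p * map_poly of_rat q"
  by (rule poly_eqI) (simp add: coeff_map_poly coeff_mult of_rat_sum of_rat_mult)

lemma map_poly_of_rat_add:
  "map_poly (of_rat :: rat \<Rightarrow> 'a::field_char_0) (p + q) = map_poly of_rat p + map_poly of_rat q"
  by (rule poly_eqI) (simp add: coeff_map_poly of_rat_add)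

text \<open>The target field is left open because rational polynomials are evaluated both at real
  radicals and at complex roots.\<close>

definition rpoly :: "rat poly \<Rightarrow> 'a::field_char_0 \<Rightarrow> 'a" where
  "rpoly p = poly (map_poly of_rat p)"

lemma rpoly_mult: "rpoly (p * q) x = rpoly p x * rpoly q x"
  by (simp add: rpoly_def map_poly_of_rat_mult)

lemma rpoly_add: "rpoly (p + q) x = rpoly p x + rpoly q x"
  by (simp add: rpoly_def map_poly_of_rat_add)

lemma rpoly_pCons: "rpoly (pCons a p) x = of_rat a + x * rpoly p x"
  by (simp add: rpoly_def map_poly_pCons)

lemma rpoly_0: "rpoly 0 x = 0"
  by (simp add: rpoly_def)

lemma rpoly_monom: "rpoly (monom a n) x = of_rat a * x ^ n"
  by (simp add: rpoly_def map_poly_monom poly_monom)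

section \<open>Divisors of X^n - b and inverses of polynomial values\<close>

lemma norm_coeff_0_if_norm_roots_eq:
  fixes p :: "complex poly"
  assumes "p \<noteq> 0" and "\<And>z. poly p z = 0 \<Longrightarrow> norm z = r"
  shows "norm (coeff p 0) = norm (lead_coeff p) * r ^ degree p"
  using assms
proof (induction "degree p" arbitrary: p)
  case 0
  then show ?case by simp
next
  case (Suc d)
  then have "\<not> constant (poly p)"
    by (simp add: constant_degree)
  then obtain z where z: "poly p z = 0"
    using fundamental_theorem_of_algebra by blast
  then obtain q where q: "p = [:-z, 1:] * q"
    by (metis poly_eq_0_iff_dvd dvdE)
  have "q \<noteq> 0"
    using q Suc.prems by auto
  have deg: "degree p = Suc (degree q)"
    unfolding q using \<open>q \<noteq> 0\<close> by (subst degree_mult_eq) auto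
  have "norm (coeff q 0) = norm (lead_coeff q) * r ^ degree q"
    using Suc.prems(2) Suc.hyps deg \<open>q \<noteq> 0\<close> q by (intro Suc.hyps(1)) auto
  moreover have "norm z = r"
    using Suc.prems z by blast
  moreover have "coeff p 0 = - z * coeff q 0"
    by (simp add: q coeff_mult)
  moreover have "lead_coeff p = lead_coeff q"
    unfolding q by (simp only: lead_coeff_mult) simp
  ultimately show ?case
    by (simp add: deg norm_mult)
qed

text \<open>Each complex root z of g satisfies z^n = x^n, hence has modulus x. Up to sign the
  constant coefficient is the leading one times the product of the roots, so taking moduli makes
  x^(degree g) a quotient of rationals.\<close>

lemma Rats_power_degree_if_dvd:
  fixes x :: real and g :: "rat poly"
  assumes x: "x > 0" "n > 0" "x ^ n = of_rat b"
    and g: "g dvd monom 1 n + [:- b:]"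
  shows "x ^ degree g \<in> \<rat>"
proof -
  let ?G = "map_poly of_rat g :: complex poly"
  obtain h where h: "monom 1 n + [:- b:] = g * h"
    using g by (elim dvdE)
  have "coeff (monom 1 n + [:- b:] :: rat poly) n = 1"
    using x(2) by (cases n) auto
  then have "g \<noteq> 0"
    using h by auto
  then have "?G \<noteq> 0"
    by (auto simp: poly_eq_iff coeff_map_poly)
  have deg: "degree ?G = degree g"
    by (simp add: degree_map_poly)
  have roots: "norm z = x" if "poly ?G z = 0" for z
  proof -
    have "rpoly (monom 1 n + [:- b:]) z = 0"
      unfolding h rpoly_mult using that by (simp add: rpoly_def)
    then have "z ^ n = of_rat b"
      unfolding rpoly_add rpoly_monom rpoly_pCons rpoly_0 by (simp add: of_rat_minus)
    also have "\<dots> = complex_of_real (x ^ n)"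
      by (simp add: x(3) of_real_of_rat)
    finally have "norm z ^ n = x ^ n"
      using x(1) by (metis norm_of_real norm_power abs_of_pos zero_less_power)
    then show ?thesis
      using x(1,2) power_eq_iff_eq_base[of n "norm z" x] by simp
  qed
  have "norm (coeff ?G 0) = norm (lead_coeff ?G) * x ^ degree g"
    using norm_coeff_0_if_norm_roots_eq[OF \<open>?G \<noteq> 0\<close> roots] by (simp add: deg)
  moreover have "norm (of_rat q :: complex) = of_rat \<bar>q\<bar>" for q
  proof -
    have "norm (of_rat q :: complex) = \<bar>of_rat q :: real\<bar>"
      by (metis norm_of_real of_real_of_rat)
    then show ?thesis
      by (simp add: abs_if of_rat_minus)
  qed
  ultimately have "of_rat \<bar>coeff g 0\<bar> = of_rat \<bar>lead_coeff g\<bar> * x ^ degree g"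
    by (simp add: coeff_map_poly deg)
  then have "x ^ degree g = of_rat (\<bar>coeff g 0\<bar> / \<bar>lead_coeff g\<bar>)"
    using \<open>g \<noteq> 0\<close> by (simp add: of_rat_divide field_simps)
  then show ?thesis
    by simp
qed

text \<open>Irreducibility of X^n - b in the form used later. The gcd of p and X^n - b has degree
  below n, so minimality of n forces degree 0; a Bezout identity, evaluated at the root x of X^n -
  b, then inverts p(x).\<close>

lemma rpoly_inverse_ex:
  fixes x :: real and p :: "rat poly"
  assumes x: "x > 0" "n > 0" "x ^ n \<in> \<rat>"
    and minimal: "\<And>k. 0 < k \<Longrightarrow> k < n \<Longrightarrow> x ^ k \<notin> \<rat>"
    and p: "p \<noteq> 0" "degree p < n"
  obtains s where "rpoly s x * rpoly p x = 1"
proof -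
  obtain b where b: "x ^ n = of_rat b"
    using x(3) by (auto elim: Rats_cases)
  let ?f = "monom 1 n + [:- b:]"
  let ?g = "gcd p ?f"
  have "degree ?g \<le> degree p"
    using p by (intro dvd_imp_degree_le) auto
  moreover have "x ^ degree ?g \<in> \<rat>"
    by (rule Rats_power_degree_if_dvd[OF x(1,2) b]) simp
  ultimately have "degree ?g = 0"
    using minimal p(2) by (metis le_less_trans gr0I)
  then have "is_unit ?g"
    using p(1) is_unit_iff_degree[of ?g] by simp
  then have g1: "?g = 1"
    by (rule is_unit_gcd_iff[THEN iffD1])
  obtain s t where "s * p + t * ?f = 1"
    using bezout_coefficients_fst_snd[of p ?f] g1 by metis
  then have "rpoly (s * p + t * ?f) x = 1"
    by (simp add: rpoly_def)
  then have "rpoly s x * rpoly p x = 1"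
    unfolding rpoly_add rpoly_mult rpoly_monom rpoly_pCons rpoly_0
    by (simp add: b of_rat_minus)
  then show ?thesis ..
qed

section \<open>Traces of rational-linear maps\<close>

interpretation Q: vector_space "\<lambda>(q::rat) (x::real). of_rat q * x"
  by unfold_locales (auto simp: algebra_simps of_rat_add of_rat_mult)

text \<open>The sum of the diagonal matrix entries. Since \<open>Q.representation\<close> is 0 off
  the span, this is the trace only for a finite independent B whose span contains all f b.\<close>

definition tr :: "real set \<Rightarrow> (real \<Rightarrow> real) \<Rightarrow> rat" where
  "tr B f = (\<Sum>b\<in>B. Q.representation B (f b) b)"

lemma mult_mem_span:
  assumes "\<And>m. m \<in> M \<Longrightarrow> x * m \<in> Q.span N" and "w \<in> Q.span M"
  shows "x * w \<in> Q.span N"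
  using assms(2)
proof (induction rule: Q.span_induct_alt)
  case base
  show ?case by (simp add: Q.span_zero)
next
  case (step c m y)
  have "x * (of_rat c * m + y) = of_rat c * (x * m) + x * y"
    by (simp add: algebra_simps)
  with step assms(1) show ?case
    by (simp add: Q.span_add Q.span_scale)
qed

lemma representation_sum_scale:
  assumes "Q.independent B" and "\<And>i. i \<in> I \<Longrightarrow> v i \<in> Q.span B"
  shows "Q.representation B (\<Sum>i\<in>I. of_rat (c i) * v i) b = (\<Sum>i\<in>I. c i * Q.representation B (v i) b)"
  using assms by (simp add: Q.representation_sum Q.representation_scale Q.span_scale)

lemma sum_representation:
  assumes "Q.independent B" "finite B" "v \<in> Q.span B"
  shows "(\<Sum>b\<in>B. of_rat (Q.representation B v b) * b) = v"
  using Q.sum_representation_eq[of B v B] assms by simp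

text \<open>An instance of tr(PA) = tr(AP): P holds the C-coordinates of the elements of B, A the
  B-coordinates of the products x * c. Both traces are the same double sum, read in two
  orders.\<close>

lemma tr_mult_basis_indep:
  assumes B: "Q.independent B" "finite B" and C: "Q.independent C" "finite C"
    and span: "Q.span B = Q.span C"
    and x: "\<And>w. w \<in> Q.span B \<Longrightarrow> x * w \<in> Q.span B"
  shows "tr B ((*) x) = tr C ((*) x)"
proof -
  have BC: "b \<in> Q.span C" if "b \<in> B" for b
    using that span Q.span_base by blast
  have CB: "c \<in> Q.span B" if "c \<in> C" for c
    using that span Q.span_base by blast
  have "tr B ((*) x) = (\<Sum>b\<in>B. \<Sum>c\<in>C. Q.representation C b c * Q.representation B (x * c) b)"
    unfolding tr_def
  proof (rule sum.cong)
    fix b assume "b \<in> B"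
    have "x * b = x * (\<Sum>c\<in>C. of_rat (Q.representation C b c) * c)"
      using sum_representation[OF C BC[OF \<open>b \<in> B\<close>]] by simp
    also have "\<dots> = (\<Sum>c\<in>C. of_rat (Q.representation C b c) * (x * c))"
      by (simp add: sum_distrib_left mult.left_commute)
    finally have eq: "x * b = (\<Sum>c\<in>C. of_rat (Q.representation C b c) * (x * c))" .
    show "Q.representation B (x * b) b =
        (\<Sum>c\<in>C. Q.representation C b c * Q.representation B (x * c) b)"
      unfolding eq using B(1) x CB by (intro representation_sum_scale) blast+
  qed simp
  also have "\<dots> = (\<Sum>c\<in>C. \<Sum>b\<in>B. Q.representation B (x * c) b * Q.representation C b c)"
    by (subst sum.swap) (simp add: mult.commute)
  also have "\<dots> = tr C ((*) x)"
    unfolding tr_def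
  proof (rule sum.cong)
    fix c assume "c \<in> C"
    have "(\<Sum>b\<in>B. of_rat (Q.representation B (x * c) b) * b) = x * c"
      using sum_representation[OF B x[OF CB[OF \<open>c \<in> C\<close>]]] .
    then show "(\<Sum>b\<in>B. Q.representation B (x * c) b * Q.representation C b c) =
        Q.representation C (x * c) c"
      using representation_sum_scale[OF C(1) BC, of B "\<lambda>b. b" "Q.representation B (x * c)" c]
      by simp
  qed simp
  finally show ?thesis .
qed

text \<open>Coordinates over a subset of a basis are also coordinates over the whole basis, and they
  vanish off the subset.\<close>

lemma representation_eq_0_if_span_Diff:
  assumes "Q.independent B" "v \<in> Q.span (B - {b})"
  shows "Q.representation B v b = 0"
proof -
  have "Q.representation B v = Q.representation (B - {b}) v"
    using assms by (intro Q.representation_extend) auto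
  then show ?thesis
    using Q.representation_ne_zero by fastforce
qed

section \<open>Multiplication by an irrational radical has trace zero\<close>

text \<open>In contrast to \<open>irrational_radicals\<close>, the positive rationals are included,
  so that quotients stay inside.\<close>

definition radicals :: "real set" where
  "radicals = {x. x > 0 \<and> (\<exists>n>0. x ^ n \<in> \<rat>)}"

lemma radicals_divide:
  assumes "x \<in> radicals" "y \<in> radicals"
  shows "x / y \<in> radicals"
proof -
  obtain m n where "m > 0" "x ^ m \<in> \<rat>" "n > 0" "y ^ n \<in> \<rat>"
    using assms by (auto simp: radicals_def)
  then have "(x ^ m) ^ n / (y ^ n) ^ m \<in> \<rat>"
    by simp
  moreover have "(x ^ m) ^ n / (y ^ n) ^ m = (x / y) ^ (m * n)"
    by (simp add: power_divide power_mult [symmetric] mult.commute)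
  ultimately show ?thesis
    using assms \<open>m > 0\<close> \<open>n > 0\<close> unfolding radicals_def
    by (auto intro!: exI[of _ "m * n"])
qed

lemma irrational_radicals_subset: "irrational_radicals \<subseteq> radicals - \<rat>"
proof
  fix x assume "x \<in> irrational_radicals"
  then obtain m b where "x = root m (of_rat b)" "b > 0" "m \<ge> 2" "x \<notin> \<rat>"
    by (auto simp: irrational_radicals_def)
  moreover from this have "x ^ m = of_rat b" "x > 0"
    by auto
  ultimately show "x \<in> radicals - \<rat>"
    by (auto simp: radicals_def intro!: exI[of _ m])
qed

section \<open>A finite-dimensional rational space stable under given radicals\<close>

text \<open>Radicals are adjoined one at a time. If u^n = b is rational, the products u^i * m with i
  < n suffice, because u^n * m falls back to b * m. M is a generating set; a basis is extracted from
  it later.\<close>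

lemma finite_dim_ex:
  assumes "finite U" "U \<subseteq> radicals"
  shows "\<exists>M. finite M \<and> 1 \<in> M \<and> (\<forall>u\<in>U. \<forall>m\<in>M. u * m \<in> Q.span M)"
  using assms
proof (induction rule: finite_induct)
  case empty
  show ?case by (intro exI[of _ "{1}"]) auto
next
  case (insert u U)
  then obtain M where M: "finite M" "1 \<in> M" "\<And>v m. v \<in> U \<Longrightarrow> m \<in> M \<Longrightarrow> v * m \<in> Q.span M"
    by auto
  obtain n b where n: "n > 0" "u ^ n = of_rat b"
    using insert.prems by (auto simp: radicals_def elim: Rats_cases)
  let ?M = "(\<lambda>(i, m). u ^ i * m) ` ({..<n} \<times> M)"
  have base: "u ^ i * m \<in> Q.span ?M" if "i < n" "m \<in> M" for i m
    using that by (intro Q.span_base) auto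
  have "finite ?M"
    using M by simp
  moreover have "1 \<in> ?M"
    using M n by (force intro: image_eqI[of _ _ "(0, 1)"])
  moreover have "v * w \<in> Q.span ?M" if v: "v \<in> insert u U" and w: "w \<in> ?M" for v w
  proof -
    obtain i m where w: "w = u ^ i * m" "i < n" "m \<in> M"
      using w by auto
    show ?thesis
    proof (cases "v = u")
      case True
      show ?thesis
      proof (cases "Suc i < n")
        case True
        then show ?thesis
          using base[of "Suc i" m] w \<open>v = u\<close> by (simp add: mult_ac)
      next
        case False
        then have "n = Suc i"
          using w by simp
        then have "v * w = of_rat b * (u ^ 0 * m)"
          using n w True by simp
        then show ?thesis
          using base[of 0 m] n w Q.span_scale by metis
      qed
    next
      case False
      then have "v * m \<in> Q.span M"
        using M v w by blast
      \<comment> \<open>The factor v is absorbed inside the old span first; multiplication by u^i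
        then maps the old span into the new one.\<close>
      then have "u ^ i * (v * m) \<in> Q.span ?M"
        using mult_mem_span[of M "u ^ i" ?M "v * m"] base w by blast
      then show ?thesis
        using w by (simp add: mult_ac)
    qed
  qed
  ultimately show ?case by blast
qed

section \<open>Bases made of blocks of powers\<close>

lemma rpoly_mem_span:
  assumes x: "\<And>b. b \<in> B \<Longrightarrow> x * b \<in> Q.span B" and w: "w \<in> Q.span B"
  shows "rpoly p x * w \<in> Q.span B"
proof (induction p)
  case 0
  show ?case by (simp add: rpoly_0 Q.span_zero)
next
  case (pCons a p)
  have "rpoly (pCons a p) x * w = of_rat a * w + x * (rpoly p x * w)"
    by (simp add: rpoly_pCons algebra_simps)
  then show ?case
    using pCons w mult_mem_span[OF x] by (simp add: Q.span_add Q.span_scale)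
qed

text \<open>The bound is put on the coefficients because at i = 0 it must force p = 0, which
  \<open>degree p < i\<close> could not express.\<close>

lemma span_Un_powers:
  assumes "v \<in> Q.span (B \<union> (\<lambda>j. x ^ j * w) ` {..<i})"
  shows "\<exists>p. (\<forall>j\<ge>i. coeff p j = 0) \<and> v - rpoly p x * w \<in> Q.span B"
  using assms
proof (induction i arbitrary: v)
  case 0
  then show ?case by (intro exI[of _ 0]) (simp add: rpoly_0)
next
  case (Suc i)
  have "B \<union> (\<lambda>j. x ^ j * w) ` {..<Suc i} = insert (x ^ i * w) (B \<union> (\<lambda>j. x ^ j * w) ` {..<i})"
    by (simp add: lessThan_Suc)
  then obtain k where "v - of_rat k * (x ^ i * w) \<in> Q.span (B \<union> (\<lambda>j. x ^ j * w) ` {..<i})"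
    using Suc.prems by (auto simp: Q.span_breakdown_eq)
  then obtain p where p: "\<forall>j\<ge>i. coeff p j = 0"
      "v - of_rat k * (x ^ i * w) - rpoly p x * w \<in> Q.span B"
    using Suc.IH by blast
  then show ?case
    by (intro exI[of _ "p + monom k i"]) (simp add: rpoly_add rpoly_monom algebra_simps)
qed

text \<open>A dependence would give a nonzero polynomial q of degree below n with q(x) * w in the
  span of B. That span is stable under x, so multiplying by the inverse of q(x), itself a polynomial
  in x, would put w into it.\<close>

lemma independent_Un_powers:
  assumes x: "x > 0" "n > 0" "x ^ n \<in> \<rat>"
    and minimal: "\<And>k. 0 < k \<Longrightarrow> k < n \<Longrightarrow> x ^ k \<notin> \<rat>"
    and B: "Q.independent B" "\<And>b. b \<in> B \<Longrightarrow> x * b \<in> Q.span B"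
    and w: "w \<notin> Q.span B" and i: "i \<le> n"
  shows "Q.independent (B \<union> (\<lambda>j. x ^ j * w) ` {..<i})"
  using i
proof (induction i)
  case 0
  then show ?case using B by simp
next
  case (Suc i)
  let ?B = "B \<union> (\<lambda>j. x ^ j * w) ` {..<i}"
  have "x ^ i * w \<notin> Q.span ?B"
  proof
    assume "x ^ i * w \<in> Q.span ?B"
    then obtain p where p: "\<forall>j\<ge>i. coeff p j = 0" "x ^ i * w - rpoly p x * w \<in> Q.span B"
      using span_Un_powers by blast
    \<comment> \<open>All coefficients of p from i on vanish, so the coefficient of X^i is -1:
      \<open>?q\<close> is nonzero and has degree at most i < n.\<close>
    let ?q = "monom (- 1) i + p"
    have "coeff ?q i \<noteq> 0"
      using p(1) by simp
    then have "?q \<noteq> 0"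
      by fastforce
    moreover have "degree ?q \<le> i"
      using p(1) by (intro degree_le) auto
    ultimately obtain s where s: "rpoly s x * rpoly ?q x = 1"
      using rpoly_inverse_ex[OF x minimal, of ?q] Suc.prems by auto
    have "- (x ^ i * w - rpoly p x * w) \<in> Q.span B"
      using p(2) by (rule Q.span_neg)
    then have "rpoly ?q x * w \<in> Q.span B"
      by (simp add: rpoly_add rpoly_monom of_rat_minus algebra_simps)
    then have "rpoly s x * (rpoly ?q x * w) \<in> Q.span B"
      using rpoly_mem_span[of B x] B(2) by blast
    moreover have "rpoly s x * (rpoly ?q x * w) = w"
      by (metis s mult.assoc mult_1)
    ultimately show False
      using w by simp
  qed
  then show ?case
    using Suc by (simp add: lessThan_Suc Q.independent_insertI)
qed

text \<open>\<open>Q.span M\<close> is a vector space over the field generated by \<open>x\<close>, so it has a rational basis made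
  of blocks \<open>w, x * w, \<dots>, x ^ (n - 1) * w\<close>, where \<open>n\<close> is the degree of \<open>x\<close>; since \<open>n \<ge> 2\<close>,
  multiplication by \<open>x\<close> has zero diagonal in such a basis.\<close>

lemma zero_diagonal_basis_ex:
  assumes x: "x \<in> radicals" "x \<notin> \<rat>"
    and M: "finite M" "\<And>m. m \<in> M \<Longrightarrow> x * m \<in> Q.span M"
  shows "\<exists>C. finite C \<and> Q.independent C \<and> Q.span C = Q.span M \<and>
    (\<forall>c\<in>C. x * c \<in> Q.span (C - {c}))"
proof -
  \<comment> \<open>The sets in P are partial bases with zero diagonal. One of greatest cardinality
    is chosen, and adjoining a block to it shows that it spans everything.\<close>
  define P where "P C \<longleftrightarrow> C \<subseteq> Q.span M \<and> Q.independent C \<and> (\<forall>c\<in>C. x * c \<in> Q.span (C - {c}))" for C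
  have bound: "finite C \<and> card C \<le> card M" if "P C" for C
    using that Q.independent_span_bound[OF M(1)] by (auto simp: P_def)
  have "P {}"
    by (simp add: P_def Q.independent_empty)
  then obtain C where C: "P C" "\<And>D. P D \<Longrightarrow> card D \<le> card C"
    using ex_has_greatest_nat[of P "{}" card "Suc (card M)"] bound by (metis less_Suc_eq_le)
  have xC: "x * c \<in> Q.span C" if "c \<in> C" for c
    using C(1) that Q.span_mono[of "C - {c}" C] by (auto simp: P_def)
  define n where "n = (LEAST n. n > 0 \<and> x ^ n \<in> \<rat>)"
  have n: "n > 0" "x ^ n \<in> \<rat>"
    using LeastI_ex[of "\<lambda>n. n > 0 \<and> x ^ n \<in> \<rat>"] x by (auto simp: radicals_def n_def)
  have minimal: "x ^ k \<notin> \<rat>" if "0 < k" "k < n" for k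
    using not_less_Least[of k "\<lambda>n. n > 0 \<and> x ^ n \<in> \<rat>"] that by (auto simp: n_def)
  have "n \<noteq> 1"
    using n x by auto
  then have n2: "n \<ge> 2"
    using n by simp
  have "x > 0"
    using x by (simp add: radicals_def)
  have "x \<noteq> 1"
    using x by auto
  have "Q.span M \<subseteq> Q.span C"
  proof
    fix w assume wM: "w \<in> Q.span M"
    show "w \<in> Q.span C"
    proof (rule ccontr)
      assume w: "w \<notin> Q.span C"
      then have "w \<noteq> 0"
        using Q.span_zero by metis
      let ?D = "C \<union> (\<lambda>j. x ^ j * w) ` {..<n}"
      have "x ^ j * w \<in> Q.span M" for j
        using wM by (induction j) (auto simp: mult.assoc intro: mult_mem_span[OF M(2)])
      moreover have "Q.independent ?D"
        using independent_Un_powers[OF \<open>x > 0\<close> n minimal _ xC w] C(1) by (simp add: P_def)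
      moreover have "x * d \<in> Q.span (?D - {d})" if d: "d \<in> ?D" for d
      proof (cases "d \<in> C")
        case True
        then have "x * d \<in> Q.span (C - {d})"
          using C(1) by (simp add: P_def)
        moreover have "C - {d} \<subseteq> ?D - {d}"
          by auto
        ultimately show ?thesis
          using Q.span_mono by blast
      next
        case False
        then obtain i where "i \<in> {..<n}" and i: "d = x ^ i * w"
          using d by blast
        then have "i < n"
          by simp
        note i = \<open>i < n\<close> i
        obtain b where b: "x ^ n = of_rat b"
          using n by (auto elim: Rats_cases)
        show ?thesis
        proof (cases "Suc i < n")
          case True
          \<comment> \<open>The next vector of the block must differ from d in order to survive in
            \<open>?D - {d}\<close>.\<close>
          have "x ^ Suc i * w \<noteq> x ^ i * w"
            using \<open>w \<noteq> 0\<close> \<open>x > 0\<close> \<open>x \<noteq> 1\<close> by simp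
          then have "x ^ Suc i * w \<in> ?D - {d}"
            using i True by blast
          then show ?thesis
            using i Q.span_base by (metis power_Suc mult.assoc)
        next
          case False
          then have "n = Suc i"
            using i by simp
          \<comment> \<open>At the end of the block, x returns to a multiple of its start w. From n
            \<ge> 2 comes i > 0, and minimality of n then separates w from d.\<close>
          then have "i > 0" "x * d = of_rat b * w"
            using n2 i b[symmetric] by auto
          moreover have "x ^ i \<noteq> 1"
            using \<open>i > 0\<close> \<open>i < n\<close> minimal[of i] by auto
          then have "w \<in> ?D - {d}"
            using i \<open>w \<noteq> 0\<close> n by (auto intro!: image_eqI[of _ _ 0])
          ultimately show ?thesis
            using Q.span_base Q.span_scale by metis
        qed
      qed
      ultimately have "P ?D"
        using C(1) by (auto simp: P_def)
      moreover have "w \<in> ?D"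
        using n by (auto intro!: image_eqI[of _ _ 0])
      then have "C \<subset> ?D"
        using w Q.span_base by auto
      ultimately show False
        using C(2) bound psubset_card_mono by (metis not_le)
    qed
  qed
  moreover have "Q.span C \<subseteq> Q.span M"
    using C(1) by (auto simp: P_def intro: Q.span_minimal[THEN subsetD] Q.subspace_span)
  ultimately show ?thesis
    using C(1) bound by (auto simp: P_def)
qed

text \<open>The trace does not depend on the basis, so it can be read off one with zero
  diagonal.\<close>

lemma tr_mult_radical:
  assumes x: "x \<in> radicals" "x \<notin> \<rat>"
    and B: "finite B" "Q.independent B" "\<And>b. b \<in> B \<Longrightarrow> x * b \<in> Q.span B"
  shows "tr B ((*) x) = 0"
proof -
  obtain C where C: "finite C" "Q.independent C" "Q.span C = Q.span B"
      "\<And>c. c \<in> C \<Longrightarrow> x * c \<in> Q.span (C - {c})"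
    using zero_diagonal_basis_ex[OF x B(1,3)] by blast
  have "tr B ((*) x) = tr C ((*) x)"
    using B C by (intro tr_mult_basis_indep) (auto intro: mult_mem_span[OF B(3)])
  also have "\<dots> = 0"
    unfolding tr_def using C by (intro sum.neutral ballI representation_eq_0_if_span_Diff) auto
  finally show ?thesis .
qed

section \<open>Independence of 1 from the irrational radicals\<close>

lemma one_notin_span_radicals: "1 \<notin> Q.span (radicals - \<rat>)"
proof
  assume "1 \<in> Q.span (radicals - \<rat>)"
  then obtain U r where U: "finite U" "U \<subseteq> radicals - \<rat>" and r: "1 = (\<Sum>u\<in>U. of_rat (r u) * u)"
    by (auto simp: Q.span_explicit)
  obtain M where M: "finite M" "1 \<in> M" "\<And>u m. u \<in> U \<Longrightarrow> m \<in> M \<Longrightarrow> u * m \<in> Q.span M"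
    using finite_dim_ex[of U] U by blast
  obtain B where B: "B \<subseteq> M" "Q.independent B" "M \<subseteq> Q.span B"
    using Q.maximal_independent_subset by blast
  have "finite B"
    using B M finite_subset by blast
  have span: "Q.span B = Q.span M"
    using B by (metis Q.span_mono Q.span_minimal Q.subspace_span subset_antisym)
  have inv: "u * b \<in> Q.span B" if "u \<in> U" "b \<in> B" for u b
    using M(3) that B(1) span by auto
  \<comment> \<open>The element 1 of M keeps the space nonzero, so the trace \<open>card B\<close>
    of the identity is a nonzero rational.\<close>
  have "B \<noteq> {}"
    using B(3) M(2) by auto
  have "Q.representation B b b = 1" if "b \<in> B" for b
    using that B(2) by (simp add: Q.representation_basis)
  then have "of_nat (card B) = (\<Sum>b\<in>B. Q.representation B b b)"
    by simp
  also have "\<dots> = (\<Sum>b\<in>B. \<Sum>u\<in>U. r u * Q.representation B (u * b) b)"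
  proof (rule sum.cong)
    fix b assume "b \<in> B"
    have "(\<Sum>u\<in>U. of_rat (r u) * u) * b = (\<Sum>u\<in>U. of_rat (r u) * (u * b))"
      by (simp add: sum_distrib_right mult.assoc)
    then have "b = (\<Sum>u\<in>U. of_rat (r u) * (u * b))"
      by (metis r mult_1)
    then show "Q.representation B b b = (\<Sum>u\<in>U. r u * Q.representation B (u * b) b)"
      using representation_sum_scale[OF B(2), of U "\<lambda>u. u * b" r b] inv \<open>b \<in> B\<close> by simp
  qed simp
  also have "\<dots> = (\<Sum>u\<in>U. r u * tr B ((*) u))"
    unfolding tr_def by (subst sum.swap) (simp add: sum_distrib_left)
  also have "\<dots> = 0"
    using U B \<open>finite B\<close> inv by (intro sum.neutral) (auto simp: tr_mult_radical)
  finally show False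
    using \<open>B \<noteq> {}\<close> \<open>finite B\<close> by simp
qed

section \<open>Reduction to a single equivalence class\<close>

lemma radical_combinations_irrational:
  assumes "\<alpha> \<in> radical_combinations"
  shows "\<alpha> \<notin> \<rat>"
proof
  assume "\<alpha> \<in> \<rat>"
  then obtain a where a: "\<alpha> = of_rat a"
    by (auto elim: Rats_cases)
  obtain n r u where u: "\<And>i. i \<in> {1..n} \<Longrightarrow> u i \<in> radicals - \<rat>"
    and nt: "not_trivially_cancelling n r u"
    and sum: "\<alpha> = (\<Sum>i=1..n. of_rat (r i) * u i)"
    using assms irrational_radicals_subset unfolding radical_combinations_def by blast
  obtain k where k: "k \<in> {1..n}" and
    ne: "(\<Sum>i\<in>radical_equiv n u `` {k}. of_rat (r i) * u i) \<noteq> 0"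
    using nt by (auto simp: not_trivially_cancelling_def quotient_def)
  define C where "C = radical_equiv n u `` {k}"
  have C_iff: "i \<in> C \<longleftrightarrow> u k / u i \<in> \<rat>" if "i \<in> {1..n}" for i
    using k that by (auto simp: C_def radical_equiv_def)
  have CI: "C \<subseteq> {1..n}"
    by (auto simp: C_def radical_equiv_def)
  \<comment> \<open>The class of k is given by u k / u i, whereas dividing by u k produces the
    inverse quotients.\<close>
  have inv: "u i / u k \<in> \<rat> \<longleftrightarrow> u k / u i \<in> \<rat>" for i
    by (metis Rats_inverse inverse_divide)
  have uk: "u k > 0" "u k \<in> radicals" "u k \<notin> \<rat>"
    using u[OF k] by (auto simp: radicals_def)
  let ?S = "Q.span (radicals - \<rat>)"
  \<comment> \<open>The class C contributes the nonzero rational q after division by u k; all other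
    terms become rational multiples of irrational radicals.\<close>
  define q where "q = (\<Sum>i\<in>C. of_rat (r i) * (u i / u k))"
  have "q \<in> \<rat>"
    unfolding q_def using C_iff CI inv by (intro Rats_sum Rats_mult) auto
  then obtain q' where q': "q = of_rat q'"
    by (auto elim: Rats_cases)
  have "q * u k = (\<Sum>i\<in>C. of_rat (r i) * u i)"
    unfolding q_def using uk by (simp add: sum_distrib_right)
  then have "q' \<noteq> 0"
    using ne q' by (auto simp: C_def)
  \<comment> \<open>Irrationality of u k itself enters here: it puts the rational \<alpha>, divided
    by u k, into the span as well.\<close>
  have "1 / u k \<in> radicals - \<rat>"
  proof -
    have "1 \<in> radicals"
      by (auto simp: radicals_def)
    moreover have "1 / u k \<notin> \<rat>"
      using uk(3) by (metis Rats_inverse inverse_eq_divide inverse_inverse_eq)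
    ultimately show ?thesis
      using uk radicals_divide by blast
  qed
  then have "of_rat a * (1 / u k) \<in> ?S"
    by (intro Q.span_scale Q.span_base)
  moreover have "(\<Sum>i\<in>{1..n}-C. of_rat (r i) * (u i / u k)) \<in> ?S"
  proof (intro Q.span_sum Q.span_scale Q.span_base)
    fix i assume "i \<in> {1..n} - C"
    then show "u i / u k \<in> radicals - \<rat>"
      using C_iff inv u radicals_divide uk by auto
  qed
  moreover have "q = of_rat a * (1 / u k) - (\<Sum>i\<in>{1..n}-C. of_rat (r i) * (u i / u k))"
  proof -
    have "of_rat a * (1 / u k) = (\<Sum>i=1..n. of_rat (r i) * (u i / u k))"
      by (simp flip: a add: sum sum_divide_distrib)
    also have "\<dots> = (\<Sum>i\<in>{1..n}-C. of_rat (r i) * (u i / u k)) + q"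
      unfolding q_def using CI by (intro sum.subset_diff) auto
    finally show ?thesis by simp
  qed
  ultimately have "of_rat q' \<in> ?S"
    unfolding q'[symmetric] by (simp only: Q.span_diff)
  then have "of_rat (inverse q') * of_rat q' \<in> ?S"
    by (rule Q.span_scale)
  then have "1 \<in> ?S"
    using \<open>q' \<noteq> 0\<close> by (simp flip: of_rat_mult)
  then show False
    using one_notin_span_radicals by blast
qed

theorem theorem1:
  fixes \<alpha> :: real
  assumes "\<alpha> \<in> radical_combinations"
  shows "\<not> (\<exists>(p :: int) (q :: nat). q \<ge> 1 \<and> \<alpha> = of_int p / of_nat q) \<and> \<alpha> \<notin> \<rat>"
  using radical_combinations_irrational[OF assms] by auto

end
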